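(* Let $n$ be large and let $B\ge \log n$ be an integer space parameter. Consider the following algorithm, run on a stream whose final frequency vector is the Zipfian vector $f\in\mathbb{R}^n$ with $f_i=1/i$ for all $i\in[n]$. Let $T=\Theta(\log\log n)$. The algorithm maintains $T$ independent CountSketch tables: $S_1,\dots,S_{T-1}$, each with $3$ rows and $\frac{B}{6T}$ columns, and $S_T$ with $3$ rows and $\frac{B}{6}$ columns; every stream update $(i,\Delta)$ is fed into all $T$ tables. To answer a query for $i\in[n]$, let $\hat f_i^{\,j}$ be the CountSketch estimate of $f_i$ from table $S_j$, and let $\tilde f_i=\mathrm{Median}(\hat f_i^{\,1},\dots,\hat f_i^{\,T-1})$. If $\tilde f_i<\tau$, where $\tau=\Theta(\log\log n)/B$, the algorithm outputs $\hat f_i=0$; otherwise it outputs $\hat f_i=\hat f_i^{\,T}$, the estimate of table $S_T$. Then, for suitable choices of the absolute constants hidden in $T=\Theta(\log\log n)$ and in $\tau$, the expected weighted error satisfies $$\mathbb{E}\left[\frac{1}{N}\sum_{i=1}^n f_i\,|f_i-\hat f_i|\right]=O\left(\frac{\log B+\mathrm{poly}(\log\log n)}{B\log n}\right),$$ where $N=\sum_{i=1}^n f_i$.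
   Context: A stream consists of updates $(i,\Delta)$ with $i\in[n]$, $\Delta\in\mathbb{R}$, and the final frequency vector $f$ has $f_i$ equal to the sum of updates to coordinate $i$. A CountSketch table with $k$ rows and $w$ columns uses independent, uniformly random hash functions $h_1,\dots,h_k:[n]\to[w]$ and sign functions $s_1,\dots,s_k:[n]\to\{-1,1\}$, maintains $C[\ell,b]=\sum_{j\in[n]}[h_\ell(j)=b]\,s_\ell(j)f_j$ (where $[\cdot]$ is the indicator), and estimates $f_i$ by $\mathrm{median}_{\ell\in[k]}\, s_\ell(i)\,C[\ell,h_\ell(i)]$. The tables $S_1,\dots,S_T$ use independent randomness. The expectation is over the randomness of the hash and sign functions. *)

theory Defs
  imports "HOL-Probability.Probability"
begin

text \<open>For an even number of values, the two middle values are averaged.\<close>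

definition median :: "real list \<Rightarrow> real" where
  "median xs = (let ys = sort xs; m = length xs in
     if odd m then ys ! (m div 2) else (ys ! (m div 2 - 1) + ys ! (m div 2)) / 2)"

type_synonym stream = "(nat \<times> real) list"

definition stream_on :: "nat \<Rightarrow> stream \<Rightarrow> bool" where
  "stream_on n \<sigma> \<longleftrightarrow> fst ` set \<sigma> \<subseteq> {1..n}"

definition freq :: "stream \<Rightarrow> nat \<Rightarrow> real" where
  "freq \<sigma> i = (\<Sum>(j, \<Delta>)\<leftarrow>\<sigma>. if j = i then \<Delta> else 0)"

text \<open>The random data of a CountSketch table: row \<open>l\<close> carries a hash function and a sign
  function.\<close>

type_synonym cs_rand = "nat \<Rightarrow> (nat \<Rightarrow> nat) \<times> (nat \<Rightarrow> real)"

abbreviation hash_of :: "cs_rand \<Rightarrow> nat \<Rightarrow> nat \<Rightarrow> nat" where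
  "hash_of r l \<equiv> fst (r l)"

abbreviation sign_of :: "cs_rand \<Rightarrow> nat \<Rightarrow> nat \<Rightarrow> real" where
  "sign_of r l \<equiv> snd (r l)"

definition countsketch_pmf :: "nat \<Rightarrow> nat \<Rightarrow> nat \<Rightarrow> cs_rand pmf" where
  "countsketch_pmf n k w = Pi_pmf {1..k} undefined (\<lambda>_.
     pair_pmf (pmf_of_set ({1..n} \<rightarrow>\<^sub>E {1..w})) (pmf_of_set ({1..n} \<rightarrow>\<^sub>E {-1, 1})))"

definition cs_update :: "cs_rand \<Rightarrow> nat \<times> real \<Rightarrow> (nat \<Rightarrow> nat \<Rightarrow> real) \<Rightarrow> nat \<Rightarrow> nat \<Rightarrow> real" where
  "cs_update r = (\<lambda>(i, \<Delta>) C l b. C l b + (if hash_of r l i = b then sign_of r l i * \<Delta> else 0))"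

definition cs_table :: "cs_rand \<Rightarrow> stream \<Rightarrow> nat \<Rightarrow> nat \<Rightarrow> real" where
  "cs_table r \<sigma> = fold (cs_update r) \<sigma> (\<lambda>_ _. 0)"

lemma cs_table_eq:
  assumes "stream_on n \<sigma>"
  shows "cs_table r \<sigma> l b =
    (\<Sum>j=1..n. of_bool (hash_of r l j = b) * sign_of r l j * freq \<sigma> j)"
proof -
  have "fold (cs_update r) \<sigma> C l b =
      C l b + (\<Sum>j=1..n. of_bool (hash_of r l j = b) * sign_of r l j * freq \<sigma> j)" for C
    using assms
  proof (induction \<sigma> arbitrary: C)
    case Nil
    then show ?case by (simp add: freq_def)
  next
    case (Cons u \<sigma>)
    obtain i \<Delta> where u: "u = (i, \<Delta>)" by (cases u)
    have i: "i \<in> {1..n}" and \<sigma>: "stream_on n \<sigma>"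
      using Cons.prems by (auto simp: stream_on_def u)
    have "(\<Sum>j=1..n. of_bool (hash_of r l j = b) * sign_of r l j * freq (u # \<sigma>) j) =
        (\<Sum>j=1..n. (if j = i then of_bool (hash_of r l i = b) * sign_of r l i * \<Delta> else 0)) +
        (\<Sum>j=1..n. of_bool (hash_of r l j = b) * sign_of r l j * freq \<sigma> j)"
      unfolding sum.distrib[symmetric]
      by (rule sum.cong) (auto simp: freq_def u algebra_simps)
    also have "(\<Sum>j=1..n. (if j = i then of_bool (hash_of r l i = b) * sign_of r l i * \<Delta> else 0)) =
        of_bool (hash_of r l i = b) * sign_of r l i * \<Delta>"
      using i by (subst sum.delta) auto
    finally show ?case
      using Cons.IH[OF \<sigma>] by (simp add: cs_update_def u)
  qed
  then show ?thesis by (simp add: cs_table_def)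
qed

definition cs_estimate :: "nat \<Rightarrow> cs_rand \<Rightarrow> stream \<Rightarrow> nat \<Rightarrow> real" where
  "cs_estimate k r \<sigma> i =
     median (map (\<lambda>l. sign_of r l i * cs_table r \<sigma> l (hash_of r l i)) [1..<Suc k])"

text \<open>The column counts \<open>B / (6 T)\<close> and \<open>B / 6\<close> are rounded down.\<close>

definition tables_pmf :: "nat \<Rightarrow> nat \<Rightarrow> nat \<Rightarrow> (nat \<Rightarrow> cs_rand) pmf" where
  "tables_pmf n B T = Pi_pmf {1..T} undefined (\<lambda>j.
     countsketch_pmf n 3 (if j = T then B div 6 else B div (6 * T)))"

definition filtered_estimate ::
  "nat \<Rightarrow> real \<Rightarrow> (nat \<Rightarrow> cs_rand) \<Rightarrow> stream \<Rightarrow> nat \<Rightarrow> real" where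
  "filtered_estimate T \<tau> \<omega> \<sigma> i =
     (if median (map (\<lambda>j. cs_estimate 3 (\<omega> j) \<sigma> i) [1..<T]) < \<tau> then 0
      else cs_estimate 3 (\<omega> T) \<sigma> i)"

definition weighted_error :: "nat \<Rightarrow> (nat \<Rightarrow> real) \<Rightarrow> (nat \<Rightarrow> real) \<Rightarrow> real" where
  "weighted_error n f g = 1 / (\<Sum>i=1..n. f i) * (\<Sum>i=1..n. f i * \<bar>f i - g i\<bar>)"

end

theory Submission
  imports Defs
begin

text \<open>
  For a single row of width \<open>w\<close>, either one of the \<open>1/t\<close> largest items collides with the queried
  item, or the remaining items, whose squared frequencies sum to \<open>O(t)\<close>, produce an error of
  size \<open>t\<close>; both have probability \<open>O(1/(t w))\<close>. A median of \<open>m\<close> independent values is off by \<open>t\<close>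
  only if half of them are, which has probability at most \<open>(4 q)\<^bsup>m/2\<^esup>\<close> if each is off with
  probability \<open>q\<close>. For three rows this is a quadratic tail, hence an expected error \<open>O(1/w)\<close>.
  For the \<open>T - 1\<close> filter tables, of width about \<open>B/(6 T)\<close>, it yields two things. An item with
  \<open>1/i \<ge> 2 \<tau>\<close> is discarded with probability \<open>O((i L/B)\<^sup>2)\<close>, where \<open>L = ln (ln n)\<close>, so these
  items lose \<open>O(L/B)\<close> in total, as do all items with \<open>1/i < 2 \<tau>\<close> even if every one is discarded.
  An item \<open>i > B\<close> is kept with probability at most \<open>3 / ln n\<close>, so the final table contributes
  \<open>O(1/B)\<close> times the harmonic sum up to \<open>B\<close>, plus \<open>O(1/B)\<close>.
\<close>

subsection \<open>Finite product distributions\<close>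

text \<open>Finite supports turn both sides into finite sums, so integrability is automatic.\<close>

lemma expectation_pair_pmf_finite:
  fixes f :: "'a \<times> 'b \<Rightarrow> real"
  assumes "finite (set_pmf p)" "finite (set_pmf q)"
  shows "measure_pmf.expectation (pair_pmf p q) f =
    measure_pmf.expectation p (\<lambda>x. measure_pmf.expectation q (\<lambda>y. f (x, y)))"
proof -
  have "measure_pmf.expectation (pair_pmf p q) f =
      (\<Sum>z\<in>set_pmf p \<times> set_pmf q. pmf (pair_pmf p q) z *\<^sub>R f z)"
    using assms by (intro integral_measure_pmf) auto
  also have "\<dots> = (\<Sum>x\<in>set_pmf p. pmf p x *\<^sub>R (\<Sum>y\<in>set_pmf q. pmf q y *\<^sub>R f (x, y)))"
    unfolding scaleR_sum_right sum.cartesian_product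
    by (intro sum.cong refl) (auto simp: pmf_pair)
  also have "\<dots> = (\<Sum>x\<in>set_pmf p. pmf p x *\<^sub>R measure_pmf.expectation q (\<lambda>y. f (x, y)))"
    using assms by (intro sum.cong refl arg_cong2[where f="scaleR"] integral_measure_pmf[symmetric]) auto
  also have "\<dots> = measure_pmf.expectation p (\<lambda>x. measure_pmf.expectation q (\<lambda>y. f (x, y)))"
    using assms by (intro integral_measure_pmf[symmetric]) auto
  finally show ?thesis .
qed

lemma finite_set_Pi_pmf:
  assumes "finite A" "\<And>x. x \<in> A \<Longrightarrow> finite (set_pmf (p x))"
  shows "finite (set_pmf (Pi_pmf A d p))"
  using assms by (simp add: set_Pi_pmf finite_PiE_dflt)

text \<open>A uniform random function has independent uniform values, so its values can be drawn one
  at a time. The default \<open>undefined\<close> is the value that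
  \<open>\<rightarrow>\<^sub>E\<close> prescribes outside \<open>I\<close>.\<close>

lemma pmf_of_set_PiE:
  assumes "finite I" "finite B" "B \<noteq> {}"
  shows "pmf_of_set (I \<rightarrow>\<^sub>E B) = Pi_pmf I undefined (\<lambda>_. pmf_of_set B)"
proof -
  have "PiE_dflt I undefined (\<lambda>_. B) = I \<rightarrow>\<^sub>E B"
    by (auto simp: PiE_dflt_def PiE_iff extensional_def)
  then show ?thesis
    using assms by (subst Pi_pmf_of_set) auto
qed

text \<open>Coordinate \<open>x\<close> is drawn last, with all others fixed. This is applied to a
  single hash value, to a single sign, and to the table with index \<open>T\<close>.\<close>

lemma expectation_Pi_pmf_remove:
  fixes g :: "('a \<Rightarrow> 'b) \<Rightarrow> real"
  assumes "finite A" "x \<in> A" "\<And>y. y \<in> A \<Longrightarrow> finite (set_pmf (p y))"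
  shows "measure_pmf.expectation (Pi_pmf A d p) g =
    measure_pmf.expectation (Pi_pmf (A - {x}) d p)
      (\<lambda>f. measure_pmf.expectation (p x) (\<lambda>y. g (f(x := y))))"
proof -
  have "Pi_pmf (insert x (A - {x})) d p =
      map_pmf (\<lambda>(y, f). f(x := y)) (pair_pmf (p x) (Pi_pmf (A - {x}) d p))"
    using assms by (intro Pi_pmf_insert) auto
  also have "\<dots> = map_pmf (\<lambda>(f, y). f(x := y)) (pair_pmf (Pi_pmf (A - {x}) d p) (p x))"
    by (subst pair_commute_pmf) (simp add: pmf.map_comp o_def case_prod_unfold)
  finally have "measure_pmf.expectation (Pi_pmf A d p) g =
      measure_pmf.expectation (pair_pmf (Pi_pmf (A - {x}) d p) (p x)) (\<lambda>z. g ((fst z)(x := snd z)))"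
    using assms by (simp add: insert_absorb case_prod_unfold)
  also have "\<dots> = measure_pmf.expectation (Pi_pmf (A - {x}) d p)
      (\<lambda>f. measure_pmf.expectation (p x) (\<lambda>y. g (f(x := y))))"
    using assms by (subst expectation_pair_pmf_finite) (auto intro!: finite_set_Pi_pmf)
  finally show ?thesis .
qed

lemma expectation_le_const:
  fixes f :: "'a \<Rightarrow> real"
  assumes "finite (set_pmf p)" "\<And>x. x \<in> set_pmf p \<Longrightarrow> f x \<le> c"
  shows "measure_pmf.expectation p f \<le> c"
proof -
  have "measure_pmf.expectation p f \<le> measure_pmf.expectation p (\<lambda>_. c)"
    using assms by (intro integral_mono_AE) (auto simp: AE_measure_pmf_iff intro: integrable_measure_pmf_finite)
  then show ?thesis by simp
qed

section \<open>Collisions and random signs\<close>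

text \<open>With all values except \<open>h j\<close> fixed, the only colliding outcome of the
  uniform \<open>h j\<close> is the fixed value \<open>h i\<close>.\<close>

lemma prob_hash_collision_le:
  assumes I: "finite I" "i \<in> I" "j \<in> I" "i \<noteq> j" and B: "finite B" "B \<noteq> {}"
  shows "measure_pmf.prob (pmf_of_set (I \<rightarrow>\<^sub>E B)) {h. h j = h i} \<le> 1 / card B"
proof -
  have "measure_pmf.prob (pmf_of_set (I \<rightarrow>\<^sub>E B)) {h. h j = h i} =
      measure_pmf.expectation (Pi_pmf I undefined (\<lambda>_. pmf_of_set B)) (indicator {h. h j = h i})"
    using assms by (simp add: pmf_of_set_PiE)
  also have "\<dots> = measure_pmf.expectation (Pi_pmf (I - {j}) undefined (\<lambda>_. pmf_of_set B))
      (\<lambda>f. measure_pmf.expectation (pmf_of_set B) (\<lambda>y. indicator {h. h j = h i} (f(j := y))))"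
    using assms by (intro expectation_Pi_pmf_remove) auto
  also have "\<dots> \<le> 1 / card B"
  proof (rule expectation_le_const)
    show "finite (set_pmf (Pi_pmf (I - {j}) undefined (\<lambda>_. pmf_of_set B)))"
      using assms by (intro finite_set_Pi_pmf) auto
    fix f :: "'a \<Rightarrow> 'b"
    have "(\<lambda>y. indicator {h. h j = h i} (f(j := y)) :: real) = indicator {f i}"
      using assms by (auto simp: indicator_def)
    then have "measure_pmf.expectation (pmf_of_set B) (\<lambda>y. indicator {h. h j = h i} (f(j := y))) =
        pmf (pmf_of_set B) (f i)"
      by (simp add: pmf.rep_eq)
    also have "\<dots> \<le> 1 / card B"
      using B by (simp add: indicator_def)
    finally show "measure_pmf.expectation (pmf_of_set B)
        (\<lambda>y. indicator {h. h j = h i} (f(j := y))) \<le> 1 / card B" .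
  qed
  finally show ?thesis .
qed

lemma finite_set_pmf_of_set_PiE:
  "finite I \<Longrightarrow> finite W \<Longrightarrow> W \<noteq> {} \<Longrightarrow> finite (set_pmf (pmf_of_set (I \<rightarrow>\<^sub>E W)))"
  by (subst set_pmf_of_set) (auto simp: PiE_eq_empty_iff intro!: finite_PiE)

lemma set_pmf_of_set_signs:
  "finite I \<Longrightarrow> set_pmf (pmf_of_set (I \<rightarrow>\<^sub>E {-1, 1::real})) = I \<rightarrow>\<^sub>E {-1, 1}"
  by (rule set_pmf_of_set) (auto simp: PiE_eq_empty_iff intro!: finite_PiE)

text \<open>For \<open>j \<noteq> k\<close>, averaging over \<open>s j\<close> alone already gives
  0; for \<open>j = k\<close> the product is 1 on the support.\<close>

lemma expectation_sign_mult:
  assumes I: "finite I" "j \<in> I" "k \<in> I"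
  shows "measure_pmf.expectation (pmf_of_set (I \<rightarrow>\<^sub>E {-1, 1::real})) (\<lambda>s. s j * s k) = of_bool (j = k)"
proof (cases "j = k")
  case True
  have "measure_pmf.expectation (pmf_of_set (I \<rightarrow>\<^sub>E {-1, 1::real})) (\<lambda>s. s j * s k) =
      measure_pmf.expectation (pmf_of_set (I \<rightarrow>\<^sub>E {-1, 1::real})) (\<lambda>s. 1)"
    using True I by (intro integral_cong_AE) (auto simp: AE_measure_pmf_iff set_pmf_of_set_signs PiE_iff dest!: bspec)
  then show ?thesis using True by simp
next
  case False
  have "measure_pmf.expectation (pmf_of_set (I \<rightarrow>\<^sub>E {-1, 1::real})) (\<lambda>s. s j * s k) =
      measure_pmf.expectation (Pi_pmf (I - {j}) undefined (\<lambda>_. pmf_of_set {-1, 1}))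
      (\<lambda>f. measure_pmf.expectation (pmf_of_set {-1, 1}) (\<lambda>y. (f(j := y)) j * (f(j := y)) k))"
    using I by (subst pmf_of_set_PiE, simp_all del: fun_upd_apply, intro expectation_Pi_pmf_remove) auto
  also have "\<dots> = 0"
    using False by (simp add: integral_pmf_of_set)
  finally show ?thesis using False by simp
qed

text \<open>Distinct signs are orthogonal, so the cross terms of the expanded square vanish.\<close>

lemma expectation_sign_sum_sq:
  fixes c :: "'a \<Rightarrow> real"
  assumes I: "finite I" "J \<subseteq> I"
  shows "measure_pmf.expectation (pmf_of_set (I \<rightarrow>\<^sub>E {-1, 1::real})) (\<lambda>s. (\<Sum>j\<in>J. c j * s j)\<^sup>2) =
    (\<Sum>j\<in>J. (c j)\<^sup>2)"
proof -
  let ?S = "pmf_of_set (I \<rightarrow>\<^sub>E {-1, 1::real})"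
  have "finite (set_pmf ?S)" using I by (intro finite_set_pmf_of_set_PiE) auto
  note int = integrable_measure_pmf_finite[OF this]
  have [simp]: "finite J" using I by (rule finite_subset[rotated])
  have "measure_pmf.expectation ?S (\<lambda>s. (\<Sum>j\<in>J. c j * s j)\<^sup>2) =
      measure_pmf.expectation ?S (\<lambda>s. \<Sum>j\<in>J. \<Sum>k\<in>J. c j * c k * (s j * s k))"
    by (simp add: power2_eq_square sum_product algebra_simps)
  also have "\<dots> = (\<Sum>j\<in>J. \<Sum>k\<in>J. c j * c k * measure_pmf.expectation ?S (\<lambda>s. s j * s k))"
    by (simp add: int)
  also have "\<dots> = (\<Sum>j\<in>J. \<Sum>k\<in>J. if j = k then (c j)\<^sup>2 else 0)"
    using I by (intro sum.cong refl) (auto simp: expectation_sign_mult subset_iff power2_eq_square)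
  also have "\<dots> = (\<Sum>j\<in>J. (c j)\<^sup>2)" by simp
  finally show ?thesis .
qed

section \<open>Amplification over independent copies\<close>

text \<open>Union bound over the sets of \<open>k = (card A + 1) div 2\<close> coordinates that are
  all bad: by independence each set has probability at most \<open>q ^ k\<close>, and there are at
  most \<open>2 ^ card A \<le> 4 ^ k\<close> of them.\<close>

lemma prob_half_bad_le:
  assumes A: "finite A" and q: "\<And>a. a \<in> A \<Longrightarrow> measure_pmf.prob (p a) E \<le> q"
  shows "measure_pmf.prob (Pi_pmf A d p) {\<omega>. card A \<le> 2 * card {a \<in> A. \<omega> a \<in> E}} \<le>
    (4 * q) ^ ((card A + 1) div 2)"
proof (cases "A = {}")
  case False
  then obtain a where "a \<in> A" by blast
  then have q0: "0 \<le> q" using q[of a] measure_nonneg[of "p a" E] by linarith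
  define k where "k = (card A + 1) div 2"
  let ?P = "Pi_pmf A d p"
  \<comment> \<open>\<open>Pi A (?B S)\<close> constrains only the coordinates in \<open>S\<close>,
    and it is a product event.\<close>
  let ?B = "\<lambda>S a. if a \<in> S then E else UNIV"
  let ?F = "{S. S \<subseteq> A \<and> card S = k}"
  have fF: "finite ?F" using A by simp
  have "{\<omega>. card A \<le> 2 * card {a \<in> A. \<omega> a \<in> E}} \<subseteq> (\<Union>S\<in>?F. Pi A (?B S))"
  proof
    fix \<omega> assume "\<omega> \<in> {\<omega>. card A \<le> 2 * card {a \<in> A. \<omega> a \<in> E}}"
    then have "k \<le> card {a \<in> A. \<omega> a \<in> E}" unfolding k_def by simp
    then obtain S where "S \<subseteq> {a \<in> A. \<omega> a \<in> E}" "card S = k"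
      using obtain_subset_with_card_n by metis
    then show "\<omega> \<in> (\<Union>S\<in>?F. Pi A (?B S))"
      by (intro UN_I[of S]) auto
  qed
  then have "measure_pmf.prob ?P {\<omega>. card A \<le> 2 * card {a \<in> A. \<omega> a \<in> E}} \<le>
      measure_pmf.prob ?P (\<Union>S\<in>?F. Pi A (?B S))"
    by (intro measure_pmf.finite_measure_mono) auto
  also have "\<dots> \<le> (\<Sum>S\<in>?F. measure_pmf.prob ?P (Pi A (?B S)))"
    using fF by (intro measure_pmf.finite_measure_subadditive_finite) auto
  also have "\<dots> \<le> (\<Sum>S\<in>?F. q ^ k)"
  proof (intro sum_mono)
    fix S assume S: "S \<in> ?F"
    have "measure_pmf.prob ?P (Pi A (?B S)) = (\<Prod>a\<in>A. measure_pmf.prob (p a) (?B S a))"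
      using A by (intro measure_Pi_pmf_Pi) auto
    also have "\<dots> = (\<Prod>a\<in>S. measure_pmf.prob (p a) (?B S a))"
      using A S by (intro prod.mono_neutral_right) auto
    also have "\<dots> \<le> (\<Prod>a\<in>S. q)"
      using S q by (intro prod_mono) auto
    also have "\<dots> = q ^ k" using S by simp
    finally show "measure_pmf.prob ?P (Pi A (?B S)) \<le> q ^ k" .
  qed
  also have "\<dots> \<le> 4 ^ k * q ^ k"
  proof -
    have "card ?F \<le> card (Pow A)" using A by (intro card_mono) auto
    also have "\<dots> = 2 ^ card A" using A by (simp add: card_Pow)
    also have "\<dots> \<le> 2 ^ (2 * k)" unfolding k_def by (intro power_increasing) auto
    finally have "card ?F \<le> 4 ^ k" by (simp add: power_mult)
    then have "real (card ?F) \<le> 4 ^ k" by (metis of_nat_le_iff of_nat_numeral of_nat_power)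
    then show ?thesis using q0 by (simp add: mult_right_mono)
  qed
  finally show ?thesis by (simp add: k_def power_mult_distrib)
qed simp

subsection \<open>Medians and elementary sums\<close>

text \<open>The lower middle entry, at index \<open>(length xs - 1) div 2\<close> of the sorted
  list, is at most the median for either parity; so it and all entries before it are at most
  \<open>x\<close>.\<close>

lemma median_le_count:
  assumes "median xs \<le> x" "xs \<noteq> []"
  shows "length xs \<le> 2 * length (filter (\<lambda>y. y \<le> x) xs)"
proof -
  define ys where "ys = sort xs"
  define k where "k = (length xs - 1) div 2"
  have ys: "sorted ys" "length ys = length xs" by (auto simp: ys_def)
  have k: "k < length ys" using assms ys by (cases xs) (auto simp: k_def)
  have "ys ! k \<le> x"
  proof (cases "odd (length xs)")
    case True
    then have "k = length xs div 2" unfolding k_def by presburger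
    then show ?thesis using assms True by (simp add: median_def ys_def)
  next
    case False
    then have "k = length xs div 2 - 1" "length xs div 2 < length ys" "k \<le> length xs div 2"
      using assms ys by (auto simp: k_def elim!: evenE)
    then show ?thesis
      using assms False sorted_nth_mono[OF ys(1), of k "length xs div 2"]
      by (auto simp: median_def ys_def Let_def field_simps)
  qed
  then have "{..k} \<subseteq> {l. l < length ys \<and> ys ! l \<le> x}"
    using k sorted_nth_mono[OF ys(1)] by (auto intro: order_trans)
  then have "card {..k} \<le> card {l. l < length ys \<and> ys ! l \<le> x}"
    by (intro card_mono) auto
  also have "\<dots> = length (filter (\<lambda>y. y \<le> x) ys)"
    by (simp add: length_filter_conv_card)
  also have "\<dots> = length (filter (\<lambda>y. y \<le> x) xs)"
    by (simp add: ys_def filter_sort)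
  finally show ?thesis unfolding k_def by simp
qed

text \<open>Mirror image of \<open>median_le_count\<close>, with the upper middle entry at index
  \<open>length xs div 2\<close>, which is at least the median.\<close>

lemma median_ge_count:
  assumes "x \<le> median xs" "xs \<noteq> []"
  shows "length xs \<le> 2 * length (filter (\<lambda>y. x \<le> y) xs)"
proof -
  define ys where "ys = sort xs"
  define k where "k = length xs div 2"
  have ys: "sorted ys" "length ys = length xs" by (auto simp: ys_def)
  have k: "k < length ys" using assms ys by (cases xs) (auto simp: k_def)
  have "x \<le> ys ! k"
  proof (cases "odd (length xs)")
    case True
    then show ?thesis using assms by (simp add: median_def ys_def k_def)
  next
    case False
    then show ?thesis
      using assms k sorted_nth_mono[OF ys(1), of "k - 1" k]
      by (auto simp: median_def ys_def k_def Let_def field_simps)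
  qed
  then have "{k..<length ys} \<subseteq> {l. l < length ys \<and> x \<le> ys ! l}"
    using k sorted_nth_mono[OF ys(1)] by (auto intro: order_trans)
  then have "card {k..<length ys} \<le> card {l. l < length ys \<and> x \<le> ys ! l}"
    by (intro card_mono) auto
  also have "\<dots> = length (filter (\<lambda>y. x \<le> y) ys)"
    by (simp add: length_filter_conv_card)
  also have "\<dots> = length (filter (\<lambda>y. x \<le> y) xs)"
    by (simp add: ys_def filter_sort)
  finally show ?thesis unfolding k_def ys(2) by simp
qed

text \<open>A median that is off by \<open>t\<close> is off to one side, and then at least half of
  the values are off to that side. For an empty range, \<open>b - a\<close> is truncated to
  0.\<close>

lemma median_error_count:
  assumes "t \<le> \<bar>median (map g [a..<b]) - c\<bar>"
  shows "b - a \<le> 2 * card {l \<in> {a..<b}. t \<le> \<bar>g l - c\<bar>}"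
proof (cases "a < b")
  case True
  let ?xs = "map g [a..<b]"
  have len: "length (filter (\<lambda>y. t \<le> \<bar>y - c\<bar>) ?xs) = card {l \<in> {a..<b}. t \<le> \<bar>g l - c\<bar>}"
  proof -
    have "length (filter (\<lambda>y. t \<le> \<bar>y - c\<bar>) ?xs) = length (filter (\<lambda>l. t \<le> \<bar>g l - c\<bar>) [a..<b])"
      by (simp add: filter_map o_def)
    also have "\<dots> = card (set (filter (\<lambda>l. t \<le> \<bar>g l - c\<bar>) [a..<b]))"
      by (intro distinct_card[symmetric]) simp
    finally show ?thesis by (simp add: Collect_conj_eq Int_commute)
  qed
  have mono: "length (filter P ?xs) \<le> length (filter Q ?xs)" if "\<And>y. P y \<Longrightarrow> Q y" for P Q
    using that by (metis (mono_tags, lifting) filter_cong filter_filter length_filter_le)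
  from assms consider "median ?xs \<le> c - t" | "c + t \<le> median ?xs" by linarith
  then have "length ?xs \<le> 2 * length (filter (\<lambda>y. t \<le> \<bar>y - c\<bar>) ?xs)"
  proof cases
    case 1
    from median_le_count[OF 1] True mono[of "\<lambda>y. y \<le> c - t" "\<lambda>y. t \<le> \<bar>y - c\<bar>"]
    show ?thesis by fastforce
  next
    case 2
    from median_ge_count[OF 2] True mono[of "\<lambda>y. c + t \<le> y" "\<lambda>y. t \<le> \<bar>y - c\<bar>"]
    show ?thesis by fastforce
  qed
  then show ?thesis using len by simp
qed simp

text \<open>Dyadic substitute for integrating the tail: level \<open>2 ^ k * s\<close> contributes
  at most \<open>2 ^ k * s * (1 / 4) ^ k\<close>, which sums to at most \<open>2 * s\<close>; values
  below \<open>s\<close> account for the remaining \<open>s\<close>.\<close>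

lemma expectation_le_of_quadratic_tail:
  fixes Y :: "'a \<Rightarrow> real"
  assumes fin: "finite (set_pmf p)" and s: "0 < s"
    and tail: "\<And>t. 0 < t \<Longrightarrow> measure_pmf.prob p {x. t \<le> Y x} \<le> (s / t)\<^sup>2"
  shows "measure_pmf.expectation p Y \<le> 3 * s"
proof -
  note int = integrable_measure_pmf_finite[OF fin]
  \<comment> \<open>Truncation at \<open>2 ^ K * s\<close> permits induction on \<open>K\<close>; it
    has no effect once \<open>2 ^ K * s\<close> reaches the maximum of \<open>Y\<close> on the
    finite support.\<close>
  have dyadic: "min y (2 ^ K * s) \<le> s + (\<Sum>k<K. 2 ^ k * s * of_bool (2 ^ k * s \<le> y))" for y :: real and K
  proof (induction K)
    case (Suc K)
    show ?case
    proof (cases "2 ^ K * s \<le> y")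
      case True
      have "min y (2 ^ Suc K * s) \<le> min y (2 ^ K * s) + 2 ^ K * s"
        using True by (simp add: min.absorb2 min.coboundedI2 mult_ac)
      also have "\<dots> \<le> (s + (\<Sum>k<K. 2 ^ k * s * of_bool (2 ^ k * s \<le> y))) + 2 ^ K * s"
        using Suc by (rule add_right_mono)
      finally show ?thesis using True by (simp add: sum.lessThan_Suc del: sum_mult_of_bool_eq)
    next
      case False
      moreover have "0 < 2 ^ K * s" using s by simp
      ultimately have "min y (2 ^ Suc K * s) = min y (2 ^ K * s)" by (simp add: min_def)
      then show ?thesis using Suc False by (simp add: sum.lessThan_Suc del: sum_mult_of_bool_eq)
    qed
  qed simp
  obtain K where K: "\<And>x. x \<in> set_pmf p \<Longrightarrow> Y x \<le> 2 ^ K * s"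
  proof -
    obtain K where "Max (Y ` set_pmf p) / s < 2 ^ K" using real_arch_pow[of 2] by auto
    then have "Max (Y ` set_pmf p) \<le> 2 ^ K * s" using s by (simp add: field_simps)
    then show ?thesis using that fin by (meson Max_ge finite_imageI imageI order_trans)
  qed
  have "measure_pmf.expectation p Y \<le>
      measure_pmf.expectation p (\<lambda>x. s + (\<Sum>k<K. 2 ^ k * s * indicator {x. 2 ^ k * s \<le> Y x} x))"
  proof (intro integral_mono_AE int)
    have "Y x \<le> s + (\<Sum>k<K. 2 ^ k * s * indicator {x. 2 ^ k * s \<le> Y x} x)" if "x \<in> set_pmf p" for x
      using dyadic[of "Y x" K] K[OF that] by (simp add: indicator_def min_def)
    then show "AE x in p. Y x \<le> s + (\<Sum>k<K. 2 ^ k * s * indicator {x. 2 ^ k * s \<le> Y x} x)"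
      by (simp add: AE_measure_pmf_iff)
  qed
  also have "\<dots> = s + (\<Sum>k<K. 2 ^ k * s * measure_pmf.prob p {x. 2 ^ k * s \<le> Y x})"
    by (simp add: int del: sum_mult_indicator)
  also have "\<dots> \<le> s + (\<Sum>k<K. 2 ^ k * s * (s / (2 ^ k * s))\<^sup>2)"
    using s by (intro add_left_mono sum_mono mult_left_mono tail) auto
  also have "\<dots> = s + s * (\<Sum>k<K. (1 / 2) ^ k)"
    using s by (simp add: sum_distrib_left power_divide power2_eq_square)
  also have "\<dots> \<le> s + s * 2"
    using s by (intro add_left_mono mult_left_mono) (auto simp: geometric_sum)
  finally show ?thesis by simp
qed

text \<open>A quotient of at least 1 loses at most half of its value when rounded down.\<close>

lemma div_ge_half:
  assumes "0 < d" "d \<le> B"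
  shows "real B / (2 * real d) \<le> real (B div d)"
proof -
  have q: "1 \<le> B div d" using assms by (simp add: Suc_leI div_greater_zero_iff)
  have "B < d * (B div d) + d"
    using assms by (metis add_less_cancel_left mod_less_divisor mult_div_mod_eq)
  also have "\<dots> \<le> 2 * (d * (B div d))" using q by simp
  finally have "real B \<le> real (2 * (d * (B div d)))" by (simp only: of_nat_le_iff)
  then show ?thesis using assms by (simp add: field_simps)
qed

text \<open>The factor 24 collects 6 from the column count, 2 from rounding and 2 from
  \<open>T \<le> 2 * L\<close>.\<close>

lemma filter_width_ge:
  assumes "1 \<le> T" "real T \<le> 2 * L" "6 * T \<le> B"
  shows "real B / (24 * L) \<le> real (B div (6 * T))"
proof -
  have "real B / (24 * L) \<le> real B / (2 * real (6 * T))"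
    using assms by (intro divide_left_mono) auto
  then show ?thesis using div_ge_half[of "6 * T" B] assms by linarith
qed

lemma harmonic_sum_le:
  assumes "1 \<le> n"
  shows "(\<Sum>i=1..n. 1 / real i) \<le> 1 + ln (real n)"
  using euler_mascheroni_sequence_decreasing[of 1 n] assms
  by (simp add: harm_def inverse_eq_divide)

lemma harmonic_sum_ge:
  assumes "1 \<le> n"
  shows "ln (real n) \<le> (\<Sum>i=1..n. 1 / real i)"
proof -
  have "ln (real n) \<le> ln (real n + 1)" using assms by simp
  also have "\<dots> \<le> harm n" by (rule ln_le_harm)
  finally show ?thesis by (simp add: harm_def inverse_eq_divide)
qed

subsection \<open>CountSketch on a Zipfian stream\<close>

definition row_pmf :: "nat set \<Rightarrow> nat set \<Rightarrow> ((nat \<Rightarrow> nat) \<times> (nat \<Rightarrow> real)) pmf" where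
  "row_pmf I W = pair_pmf (pmf_of_set (I \<rightarrow>\<^sub>E W)) (pmf_of_set (I \<rightarrow>\<^sub>E {-1, 1}))"

lemma finite_set_row_pmf:
  "finite I \<Longrightarrow> finite W \<Longrightarrow> W \<noteq> {} \<Longrightarrow> finite (set_pmf (row_pmf I W))"
  by (simp add: row_pmf_def finite_set_pmf_of_set_PiE)

text \<open>For a fixed hash function, averaging over the signs leaves only the squares of the
  colliding items; averaging over the hash function then weights each by its collision
  probability.\<close>

lemma expectation_collision_sum_sq:
  assumes I: "finite I" "J \<subseteq> I" "i \<in> I" "i \<notin> J" and W: "finite W" "W \<noteq> {}"
  shows "measure_pmf.expectation (row_pmf I W) (\<lambda>(h, s). (\<Sum>j\<in>J. of_bool (h j = h i) * s j * f j)\<^sup>2) \<le>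
    (\<Sum>j\<in>J. (f j)\<^sup>2) / card W"
proof -
  let ?H = "pmf_of_set (I \<rightarrow>\<^sub>E W)"
  have fH: "finite (set_pmf ?H)" using I W by (intro finite_set_pmf_of_set_PiE)
  have fS: "finite (set_pmf (pmf_of_set (I \<rightarrow>\<^sub>E {-1, 1::real})))" using I by (intro finite_set_pmf_of_set_PiE) auto
  have "measure_pmf.expectation (row_pmf I W) (\<lambda>(h, s). (\<Sum>j\<in>J. of_bool (h j = h i) * s j * f j)\<^sup>2) =
      measure_pmf.expectation ?H (\<lambda>h. measure_pmf.expectation (pmf_of_set (I \<rightarrow>\<^sub>E {-1, 1::real}))
        (\<lambda>s. (\<Sum>j\<in>J. (of_bool (h j = h i) * f j) * s j)\<^sup>2))"
    unfolding row_pmf_def by (subst expectation_pair_pmf_finite[OF fH fS]) (simp add: algebra_simps)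
  also have "\<dots> = measure_pmf.expectation ?H (\<lambda>h. \<Sum>j\<in>J. (f j)\<^sup>2 * indicator {h. h j = h i} h)"
    unfolding expectation_sign_sum_sq[OF I(1,2)]
    by (intro Bochner_Integration.integral_cong refl sum.cong) (auto simp: power_mult_distrib)
  also have "\<dots> = (\<Sum>j\<in>J. (f j)\<^sup>2 * measure_pmf.prob ?H {h. h j = h i})"
    by (simp add: integrable_measure_pmf_finite[OF fH])
  also have "\<dots> \<le> (\<Sum>j\<in>J. (f j)\<^sup>2 * (1 / card W))"
    using I W by (intro sum_mono mult_left_mono prob_hash_collision_le) auto
  finally show ?thesis by (simp add: sum_divide_distrib)
qed

lemma sum_inverse_squares_tail_le:
  "(\<Sum>j=Suc m..n. 1 / (real j)\<^sup>2) \<le> 2 / real (Suc m)"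
proof (cases "Suc m \<le> n")
  case True
  \<comment> \<open>The subtracted \<open>1 / real n\<close> strengthens the claim so that the
    induction telescopes.\<close>
  then have "(\<Sum>j=Suc m..n. 1 / (real j)\<^sup>2) \<le> 2 / real (Suc m) - 1 / real n"
  proof (induction n rule: dec_induct)
    case base
    have "1 / (real (Suc m))\<^sup>2 \<le> 1 / real (Suc m)"
      by (intro divide_left_mono) (auto simp: power2_eq_square)
    then show ?case by (simp add: diff_divide_distrib[symmetric])
  next
    case (step n)
    then have "0 < n" by simp
    then have "1 / real n - 1 / real (Suc n) = 1 / (real n * real (Suc n))"
      by (simp add: field_simps)
    moreover have "1 / (real (Suc n))\<^sup>2 \<le> 1 / (real n * real (Suc n))"
      using \<open>0 < n\<close> by (intro divide_left_mono) (auto simp: power2_eq_square)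
    ultimately have "1 / (real (Suc n))\<^sup>2 \<le> 1 / real n - 1 / real (Suc n)"
      by simp
    then show ?case using step by simp
  qed
  moreover have "0 \<le> 1 / real n" by simp
  ultimately show ?thesis by linarith
qed simp

text \<open>Splitting at rank \<open>1 / t\<close> balances the two sources of error. Collisions
  with the larger items cost at most \<open>1 / (t * w)\<close>; the smaller items have second
  moment at most \<open>2 * t / w\<close>, so Markov at level \<open>t\<^sup>2\<close> costs
  \<open>2 / (t * w)\<close>.\<close>

lemma row_tail:
  assumes i: "i \<in> {1..n}" and w: "0 < w" and t: "0 < t"
    and f: "\<And>j. j \<in> {1..n} \<Longrightarrow> f j = 1 / real j"
  shows "measure_pmf.prob (row_pmf {1..n} {1..w})
      {(h, s). t \<le> \<bar>s i * (\<Sum>j=1..n. of_bool (h j = h i) * s j * f j) - f i\<bar>} \<le> 3 / (t * real w)"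
proof -
  let ?M = "row_pmf {1..n} {1..w}"
  define m where "m = nat \<lfloor>1 / t\<rfloor>"
  have m: "real m \<le> 1 / t" "1 / t \<le> real (Suc m)"
    using t by (auto simp: m_def) linarith
  define A where "A = {j \<in> {1..n}. j \<le> m \<and> j \<noteq> i}"
  define J where "J = {j \<in> {1..n}. m < j \<and> j \<noteq> i}"
  \<comment> \<open>\<open>Z\<close> omits the factor \<open>s i\<close>, which has absolute value 1
    on the support.\<close>
  define Z where "Z = (\<lambda>(h, s). \<Sum>j\<in>J. of_bool ((h j :: nat) = h i) * (s j :: real) * f j)"
  let ?C = "\<lambda>j. {(h, s :: nat \<Rightarrow> real). (h j :: nat) = h i}"
  let ?E = "{(h, s). t \<le> \<bar>s i * (\<Sum>j=1..n. of_bool ((h j :: nat) = h i) * s j * f j) - f i\<bar>}"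
  have fin: "finite (set_pmf ?M)" using w by (intro finite_set_row_pmf) auto
  have [simp]: "finite A" "finite J" by (auto simp: A_def J_def)
  \<comment> \<open>Only on the support is \<open>s i\<close> a sign, so that
    \<open>s i * s i = 1\<close> recovers \<open>f i\<close> exactly.\<close>
  have sub: "?E \<inter> set_pmf ?M \<subseteq> (\<Union>j\<in>A. ?C j) \<union> {x. t\<^sup>2 \<le> (Z x)\<^sup>2}"
  proof
    fix x assume x: "x \<in> ?E \<inter> set_pmf ?M"
    obtain h s where hs: "x = (h, s)" by (cases x)
    have "s \<in> {1..n} \<rightarrow>\<^sub>E {-1, 1}" using x hs by (simp add: row_pmf_def set_pmf_of_set_signs)
    then have s: "s i = -1 \<or> s i = 1" using i by (auto simp: PiE_iff)
    show "x \<in> (\<Union>j\<in>A. ?C j) \<union> {x. t\<^sup>2 \<le> (Z x)\<^sup>2}"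
    proof (cases "\<exists>j\<in>A. h j = h i")
      case False
      have "{1..n} = insert i (A \<union> J)" using i by (auto simp: A_def J_def)
      then have "(\<Sum>j=1..n. of_bool (h j = h i) * s j * f j) =
          (\<Sum>j\<in>insert i (A \<union> J). of_bool (h j = h i) * s j * f j)" by simp
      also have "\<dots> = s i * f i + (\<Sum>j\<in>A \<union> J. of_bool (h j = h i) * s j * f j)"
        by (subst sum.insert) (auto simp: A_def J_def)
      also have "(\<Sum>j\<in>A \<union> J. of_bool (h j = h i) * s j * f j) =
          (\<Sum>j\<in>A. of_bool (h j = h i) * s j * f j) + Z x"
        unfolding Z_def hs by (subst sum.union_disjoint) (auto simp: A_def J_def)
      also have "(\<Sum>j\<in>A. of_bool (h j = h i) * s j * f j) = 0"
        using False by (intro sum.neutral) auto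
      finally have "s i * (\<Sum>j=1..n. of_bool (h j = h i) * s j * f j) - f i = s i * Z x"
        using s by auto
      then have "t \<le> \<bar>Z x\<bar>" using x s hs by auto
      then have "t\<^sup>2 \<le> \<bar>Z x\<bar>\<^sup>2" using t by (intro power_mono) auto
      then show ?thesis by simp
    qed (auto simp: hs)
  qed
  have "measure_pmf.prob ?M ?E = measure_pmf.prob ?M (?E \<inter> set_pmf ?M)"
    by (simp add: measure_Int_set_pmf)
  also have "\<dots> \<le> measure_pmf.prob ?M ((\<Union>j\<in>A. ?C j) \<union> {x. t\<^sup>2 \<le> (Z x)\<^sup>2})"
    by (intro measure_pmf.finite_measure_mono sub) auto
  also have "\<dots> \<le> measure_pmf.prob ?M (\<Union>j\<in>A. ?C j) + measure_pmf.prob ?M {x. t\<^sup>2 \<le> (Z x)\<^sup>2}"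
    by (intro measure_subadditive) auto
  also have "measure_pmf.prob ?M (\<Union>j\<in>A. ?C j) \<le> (\<Sum>j\<in>A. measure_pmf.prob ?M (?C j))"
    by (intro measure_pmf.finite_measure_subadditive_finite) auto
  also have "(\<Sum>j\<in>A. measure_pmf.prob ?M (?C j)) \<le> (\<Sum>j\<in>A. 1 / real w)"
  proof (intro sum_mono)
    fix j assume j: "j \<in> A"
    have "measure_pmf.prob ?M (?C j) = measure_pmf.prob (map_pmf fst ?M) {h. h j = h i}"
      unfolding measure_map_pmf by (intro arg_cong[where f="measure_pmf.prob ?M"]) auto
    also have "\<dots> \<le> 1 / real (card {1..w})"
      unfolding row_pmf_def map_fst_pair_pmf using i j w
      by (intro prob_hash_collision_le) (auto simp: A_def)
    finally show "measure_pmf.prob ?M (?C j) \<le> 1 / real w" by simp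
  qed
  also have "\<dots> \<le> real m * (1 / real w)"
  proof -
    have "card A \<le> card {1..m}" by (intro card_mono) (auto simp: A_def)
    then show ?thesis by (simp add: divide_right_mono)
  qed
  also have "\<dots> \<le> (1 / t) * (1 / real w)"
    using m by (intro mult_right_mono) auto
  also have "measure_pmf.prob ?M {x. t\<^sup>2 \<le> (Z x)\<^sup>2} \<le> measure_pmf.expectation ?M (\<lambda>x. (Z x)\<^sup>2) / t\<^sup>2"
    using integral_Markov_inequality_measure[of ?M "\<lambda>x. (Z x)\<^sup>2" UNIV "t\<^sup>2",
      OF integrable_measure_pmf_finite[OF fin]] t by simp
  also have "measure_pmf.expectation ?M (\<lambda>x. (Z x)\<^sup>2) \<le> (\<Sum>j\<in>J. (f j)\<^sup>2) / real (card {1..w})"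
  proof -
    have "(\<lambda>x. (Z x)\<^sup>2) = (\<lambda>(h, s). (\<Sum>j\<in>J. of_bool (h j = h i) * s j * f j)\<^sup>2)"
      by (auto simp: Z_def fun_eq_iff)
    moreover have "J \<subseteq> {1..n}" "i \<notin> J" by (auto simp: J_def)
    ultimately show ?thesis
      using i w expectation_collision_sum_sq[of "{1..n}" J i "{1..w}" f] by simp
  qed
  also have "(\<Sum>j\<in>J. (f j)\<^sup>2) \<le> 2 * t"
  proof -
    have "(\<Sum>j\<in>J. (f j)\<^sup>2) = (\<Sum>j\<in>J. 1 / (real j)\<^sup>2)"
      using f by (intro sum.cong) (auto simp: J_def power_divide)
    also have "\<dots> \<le> (\<Sum>j=Suc m..n. 1 / (real j)\<^sup>2)"
      by (intro sum_mono2) (auto simp: J_def)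
    also have "\<dots> \<le> 2 / real (Suc m)" by (rule sum_inverse_squares_tail_le)
    also have "\<dots> \<le> 2 / (1 / t)" using m t by (intro divide_left_mono) auto
    finally show ?thesis by simp
  qed
  also have "1 / t * (1 / real w) + 2 * t / real (card {1..w}) / t\<^sup>2 = 3 / (t * real w)"
    using t w by (simp add: field_simps power2_eq_square)
  finally show ?thesis using t w by (auto simp: divide_right_mono)
qed

lemma countsketch_pmf_eq:
  "countsketch_pmf n k w = Pi_pmf {1..k} undefined (\<lambda>_. row_pmf {1..n} {1..w})"
  by (simp add: countsketch_pmf_def row_pmf_def)

lemma finite_set_countsketch_pmf: "0 < w \<Longrightarrow> finite (set_pmf (countsketch_pmf n k w))"
  unfolding countsketch_pmf_eq by (intro finite_set_Pi_pmf finite_set_row_pmf) auto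

section \<open>Tails of one table and of a median of tables\<close>

locale zipf_stream =
  fixes n :: nat and \<sigma> :: stream
  assumes stream: "stream_on n \<sigma>"
    and freq: "\<And>i. i \<in> {1..n} \<Longrightarrow> freq \<sigma> i = 1 / real i"
begin

text \<open>Two of the three rows must be off, hence the exponent 2 and \<open>12 = 4 * 3\<close>.
  The square matters: the linear tail bound of a single row would not be integrable at
  infinity.\<close>

lemma countsketch_tail:
  assumes i: "i \<in> {1..n}" and w: "0 < w" and t: "0 < t"
  shows "measure_pmf.prob (countsketch_pmf n 3 w) {r. t \<le> \<bar>cs_estimate 3 r \<sigma> i - freq \<sigma> i\<bar>} \<le>
    (12 / (t * real w))\<^sup>2"
proof -
  let ?E = "{(h, s). t \<le> \<bar>s i * (\<Sum>j=1..n. of_bool ((h j :: nat) = h i) * s j * freq \<sigma> j) - freq \<sigma> i\<bar>}"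
  have "{r. t \<le> \<bar>cs_estimate 3 r \<sigma> i - freq \<sigma> i\<bar>} \<subseteq>
      {r. card {1..3::nat} \<le> 2 * card {l \<in> {1..3}. r l \<in> ?E}}"
  proof
    fix r assume "r \<in> {r. t \<le> \<bar>cs_estimate 3 r \<sigma> i - freq \<sigma> i\<bar>}"
    then have "Suc 3 - 1 \<le> 2 * card {l \<in> {1..<Suc 3}. t \<le>
        \<bar>sign_of r l i * cs_table r \<sigma> l (hash_of r l i) - freq \<sigma> i\<bar>}"
      unfolding cs_estimate_def by (intro median_error_count) simp
    then show "r \<in> {r. card {1..3::nat} \<le> 2 * card {l \<in> {1..3}. r l \<in> ?E}}"
      unfolding atLeastLessThanSuc_atLeastAtMost
      by (simp add: cs_table_eq[OF stream] case_prod_unfold)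
  qed
  then have "measure_pmf.prob (countsketch_pmf n 3 w) {r. t \<le> \<bar>cs_estimate 3 r \<sigma> i - freq \<sigma> i\<bar>} \<le>
      measure_pmf.prob (countsketch_pmf n 3 w) {r. card {1..3::nat} \<le> 2 * card {l \<in> {1..3}. r l \<in> ?E}}"
    by (intro measure_pmf.finite_measure_mono) auto
  also have "\<dots> \<le> (4 * (3 / (t * real w))) ^ ((card {1..3::nat} + 1) div 2)"
    unfolding countsketch_pmf_eq using row_tail[OF i w t freq] by (intro prob_half_bad_le) auto
  finally show ?thesis by simp
qed

lemma countsketch_expected_error:
  assumes i: "i \<in> {1..n}" and w: "0 < w"
  shows "measure_pmf.expectation (countsketch_pmf n 3 w) (\<lambda>r. \<bar>freq \<sigma> i - cs_estimate 3 r \<sigma> i\<bar>) \<le>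
    36 / real w"
proof -
  have "measure_pmf.expectation (countsketch_pmf n 3 w) (\<lambda>r. \<bar>freq \<sigma> i - cs_estimate 3 r \<sigma> i\<bar>) \<le>
      3 * (12 / real w)"
    using countsketch_tail[OF i w] w
    by (intro expectation_le_of_quadratic_tail finite_set_countsketch_pmf)
       (auto simp: abs_minus_commute mult.commute)
  then show ?thesis by simp
qed

lemma median_of_tables_tail:
  assumes i: "i \<in> {1..n}" and w: "0 < w" and t: "0 < t" and T: "1 \<le> T"
  shows "measure_pmf.prob (Pi_pmf {1..<T} undefined (\<lambda>_. countsketch_pmf n 3 w))
      {\<omega>. t \<le> \<bar>median (map (\<lambda>j. cs_estimate 3 (\<omega> j) \<sigma> i) [1..<T]) - freq \<sigma> i\<bar>} \<le>
    ((24 / (t * real w))\<^sup>2) ^ (T div 2)"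
proof -
  let ?P = "Pi_pmf {1..<T} undefined (\<lambda>_. countsketch_pmf n 3 w)"
  let ?E = "{r. t \<le> \<bar>cs_estimate 3 r \<sigma> i - freq \<sigma> i\<bar>}"
  have "{\<omega>. t \<le> \<bar>median (map (\<lambda>j. cs_estimate 3 (\<omega> j) \<sigma> i) [1..<T]) - freq \<sigma> i\<bar>} \<subseteq>
      {\<omega>. card {1..<T} \<le> 2 * card {j \<in> {1..<T}. \<omega> j \<in> ?E}}"
    by (auto dest: median_error_count)
  then have "measure_pmf.prob ?P
      {\<omega>. t \<le> \<bar>median (map (\<lambda>j. cs_estimate 3 (\<omega> j) \<sigma> i) [1..<T]) - freq \<sigma> i\<bar>} \<le>
      measure_pmf.prob ?P {\<omega>. card {1..<T} \<le> 2 * card {j \<in> {1..<T}. \<omega> j \<in> ?E}}"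
    by (intro measure_pmf.finite_measure_mono) auto
  also have "\<dots> \<le> (4 * (12 / (t * real w))\<^sup>2) ^ ((card {1..<T} + 1) div 2)"
    using countsketch_tail[OF i w t] by (intro prob_half_bad_le) auto
  \<comment> \<open>There are \<open>T - 1\<close> tables, so the exponent
    \<open>(T - 1 + 1) div 2\<close> is \<open>T div 2\<close>; and
    \<open>4 * 12\<^sup>2 = 24\<^sup>2\<close>.\<close>
  finally show ?thesis using T by (simp add: power_divide)
qed

section \<open>Mistakes of the filter\<close>

text \<open>The filter decision depends only on the tables below \<open>T\<close>, so it is
  independent of the final table. A discarded item costs \<open>freq \<sigma> i\<close>, a kept one
  the error of the final table; drawing that table last separates the two factors.\<close>

lemma filtered_expected_error:
  fixes \<tau> :: real
  assumes i: "i \<in> {1..n}" and T: "1 \<le> T" and w: "0 < B div (6 * T)"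
  defines "F \<equiv> \<lambda>\<omega>. median (map (\<lambda>j. cs_estimate 3 (\<omega> j) \<sigma> i) [1..<T]) < \<tau>"
    and "P \<equiv> Pi_pmf {1..<T} undefined (\<lambda>_. countsketch_pmf n 3 (B div (6 * T)))"
  shows "measure_pmf.expectation (tables_pmf n B T) (\<lambda>\<omega>. \<bar>freq \<sigma> i - filtered_estimate T \<tau> \<omega> \<sigma> i\<bar>) \<le>
    freq \<sigma> i * measure_pmf.prob P {\<omega>. F \<omega>} +
    36 / real (B div 6) * measure_pmf.prob P {\<omega>. \<not> F \<omega>}"
proof -
  let ?p = "\<lambda>j. countsketch_pmf n 3 (if j = T then B div 6 else B div (6 * T))"
  let ?err = "\<lambda>r. \<bar>freq \<sigma> i - cs_estimate 3 r \<sigma> i\<bar>"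
  have "B div (6 * T) \<le> B div 6" using T by (intro div_le_mono2) auto
  then have w': "0 < B div 6" using w by linarith
  have P: "Pi_pmf ({1..T} - {T}) undefined ?p = P"
    unfolding P_def using T by (intro Pi_pmf_cong) auto
  have finP: "finite (set_pmf P)"
    unfolding P_def using w by (intro finite_set_Pi_pmf finite_set_countsketch_pmf) auto
  note fin = finite_set_countsketch_pmf[OF w', of n 3]
  note int = integrable_measure_pmf_finite[OF finP]
  have f0: "0 \<le> freq \<sigma> i" using freq[OF i] by simp
  have filt: "\<bar>freq \<sigma> i - filtered_estimate T \<tau> (fun_upd \<omega> T r) \<sigma> i\<bar> =
      freq \<sigma> i * indicator {\<omega>. F \<omega>} \<omega> + indicator {\<omega>. \<not> F \<omega>} \<omega> * ?err r" for \<omega> r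
  proof -
    have "map (\<lambda>j. cs_estimate 3 (fun_upd \<omega> T r j) \<sigma> i) [1..<T] = map (\<lambda>j. cs_estimate 3 (\<omega> j) \<sigma> i) [1..<T]"
      by (intro map_cong) auto
    then have "(median (map (\<lambda>j. cs_estimate 3 (fun_upd \<omega> T r j) \<sigma> i) [1..<T]) < \<tau>) = F \<omega>"
      unfolding F_def by (rule arg_cong)
    then show ?thesis
      unfolding filtered_estimate_def using f0 by simp
  qed
  have "measure_pmf.expectation (tables_pmf n B T) (\<lambda>\<omega>. \<bar>freq \<sigma> i - filtered_estimate T \<tau> \<omega> \<sigma> i\<bar>) =
      measure_pmf.expectation P (\<lambda>\<omega>. measure_pmf.expectation (?p T)
        (\<lambda>r. \<bar>freq \<sigma> i - filtered_estimate T \<tau> (fun_upd \<omega> T r) \<sigma> i\<bar>))"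
    unfolding tables_pmf_def P[symmetric] using T w w'
    by (intro expectation_Pi_pmf_remove) (auto intro!: finite_set_countsketch_pmf)
  also have "\<dots> = measure_pmf.expectation P (\<lambda>\<omega>. freq \<sigma> i * indicator {\<omega>. F \<omega>} \<omega> +
      indicator {\<omega>. \<not> F \<omega>} \<omega> * measure_pmf.expectation (countsketch_pmf n 3 (B div 6)) ?err)"
    unfolding filt by (simp add: integrable_measure_pmf_finite[OF fin])
  also have "\<dots> \<le> measure_pmf.expectation P (\<lambda>\<omega>. freq \<sigma> i * indicator {\<omega>. F \<omega>} \<omega> +
      indicator {\<omega>. \<not> F \<omega>} \<omega> * (36 / real (B div 6)))"
    using countsketch_expected_error[OF i w']
    by (intro integral_mono int add_left_mono mult_left_mono) auto
  also have "\<dots> = freq \<sigma> i * measure_pmf.prob P {\<omega>. F \<omega>} +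
      36 / real (B div 6) * measure_pmf.prob P {\<omega>. \<not> F \<omega>}"
    by (simp add: int)
  finally show ?thesis .
qed

text \<open>Since \<tau> is at most half of \<open>1 / i\<close>, discarding the item forces the
  median to be off by at least \<open>1 / (2 * i)\<close>.\<close>

lemma prob_discard_heavy_le:
  fixes L \<tau> :: real
  assumes L: "1 \<le> L" and T: "2 \<le> T" "real T \<le> 2 * L" and B: "6 * T \<le> B"
    and \<tau>: "\<tau> = 4000 * L / real B" and i: "i \<in> {1..n}" and heavy: "2 * \<tau> \<le> 1 / real i"
  shows "measure_pmf.prob (Pi_pmf {1..<T} undefined (\<lambda>_. countsketch_pmf n 3 (B div (6 * T))))
      {\<omega>. median (map (\<lambda>j. cs_estimate 3 (\<omega> j) \<sigma> i) [1..<T]) < \<tau>} \<le> (1152 * real i * L / real B)\<^sup>2"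
proof -
  let ?w = "B div (6 * T)" and ?t = "1 / (2 * real i)"
  have i0: "0 < real i" and B0: "0 < real B" using i T B by auto
  have w: "real B / (24 * L) \<le> real ?w"
    using T B by (intro filter_width_ge) auto
  moreover have "0 < real B / (24 * L)" using L B0 by simp
  ultimately have w0: "0 < real ?w" by linarith
  have q: "24 / (?t * real ?w) \<le> 1152 * real i * L / real B"
  proof -
    have "24 / (?t * real ?w) = 48 * real i / real ?w" by simp
    also have "\<dots> \<le> 48 * real i / (real B / (24 * L))"
      using w w0 \<open>0 < real B / (24 * L)\<close> i0 by (intro divide_left_mono mult_pos_pos) auto
    finally show ?thesis using L by (simp add: field_simps)
  qed
  \<comment> \<open>For this \<tau>, the hypothesis \<open>heavy\<close> says
    \<open>8000 * i * L \<le> B\<close>.\<close>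
  have q1: "1152 * real i * L / real B \<le> 1"
    using heavy i0 B0 unfolding \<tau> by (simp add: field_simps)
  have "measure_pmf.prob (Pi_pmf {1..<T} undefined (\<lambda>_. countsketch_pmf n 3 ?w))
      {\<omega>. median (map (\<lambda>j. cs_estimate 3 (\<omega> j) \<sigma> i) [1..<T]) < \<tau>} \<le>
    measure_pmf.prob (Pi_pmf {1..<T} undefined (\<lambda>_. countsketch_pmf n 3 ?w))
      {\<omega>. ?t \<le> \<bar>median (map (\<lambda>j. cs_estimate 3 (\<omega> j) \<sigma> i) [1..<T]) - freq \<sigma> i\<bar>}"
  proof (intro measure_pmf.finite_measure_mono subsetI)
    have "1 / real i = ?t + ?t" by simp
    then show "\<omega> \<in> {\<omega>. ?t \<le> \<bar>median (map (\<lambda>j. cs_estimate 3 (\<omega> j) \<sigma> i) [1..<T]) - freq \<sigma> i\<bar>}"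
      if "\<omega> \<in> {\<omega>. median (map (\<lambda>j. cs_estimate 3 (\<omega> j) \<sigma> i) [1..<T]) < \<tau>}" for \<omega>
      using that heavy freq[OF i] by auto
  qed simp
  also have "\<dots> \<le> ((24 / (?t * real ?w))\<^sup>2) ^ (T div 2)"
    using i0 w0 T i by (intro median_of_tables_tail) auto
  also have "\<dots> \<le> ((1152 * real i * L / real B)\<^sup>2) ^ (T div 2)"
    using q i0 w0 by (intro power_mono) auto
  \<comment> \<open>The exponent is at least 1 because \<open>T \<ge> 2\<close>. Quadratic decay
    suffices here: it cancels the weight \<open>1 / i\<^sup>2\<close> of a discarded item.\<close>
  also have "\<dots> \<le> ((1152 * real i * L / real B)\<^sup>2) ^ 1"
    using q1 L T i0 B0 by (intro power_decreasing) (auto simp: power_le_one)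
  finally show ?thesis by simp
qed

text \<open>Keeping such an item forces the median to overshoot by at least
  \<open>\<tau> / 2\<close>. The base of the tail bound is then at most a constant below 1, and
  about \<open>L\<close> tables make the probability exponentially small in
  \<open>L\<close>.\<close>

lemma prob_keep_light_le:
  fixes L \<tau> :: real
  assumes L: "1 \<le> L" and T: "1 \<le> T" "L \<le> real T" "real T \<le> 2 * L" and B: "6 * T \<le> B"
    and \<tau>: "\<tau> = 4000 * L / real B" and i: "i \<in> {1..n}" and light: "2 / real i \<le> \<tau>"
  shows "measure_pmf.prob (Pi_pmf {1..<T} undefined (\<lambda>_. countsketch_pmf n 3 (B div (6 * T))))
      {\<omega>. \<not> median (map (\<lambda>j. cs_estimate 3 (\<omega> j) \<sigma> i) [1..<T]) < \<tau>} \<le> 3 / exp L"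
proof -
  let ?w = "B div (6 * T)" and ?t = "\<tau> / 2"
  have B0: "0 < real B" using T B by auto
  then have \<tau>0: "0 < \<tau>" using L by (simp add: \<tau>)
  have w: "real B / (24 * L) \<le> real ?w"
    using T B by (intro filter_width_ge) auto
  moreover have "0 < real B / (24 * L)" using L B0 by simp
  ultimately have w0: "0 < real ?w" by linarith
  \<comment> \<open>The target \<open>exp (-1)\<close> turns the exponent
    \<open>2 * (T div 2)\<close> directly into a power of \<open>e\<close>.\<close>
  have q: "24 / (?t * real ?w) \<le> exp (-1)"
  proof -
    have "24 / (?t * real ?w) \<le> 24 / (?t * (real B / (24 * L)))"
      using w w0 \<open>0 < real B / (24 * L)\<close> \<tau>0 by (intro divide_left_mono mult_left_mono mult_pos_pos) auto
    \<comment> \<open>The constant \<open>4000\<close> in \<open>\<tau>\<close> is chosen for this step.\<close>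
    also have "\<dots> \<le> 1 / 3" using L B0 by (simp add: \<tau> field_simps)
    also have "\<dots> \<le> 1 / exp 1" using exp_le by (intro divide_left_mono) auto
    finally show ?thesis by (simp add: exp_minus inverse_eq_divide)
  qed
  have "measure_pmf.prob (Pi_pmf {1..<T} undefined (\<lambda>_. countsketch_pmf n 3 ?w))
      {\<omega>. \<not> median (map (\<lambda>j. cs_estimate 3 (\<omega> j) \<sigma> i) [1..<T]) < \<tau>} \<le>
    measure_pmf.prob (Pi_pmf {1..<T} undefined (\<lambda>_. countsketch_pmf n 3 ?w))
      {\<omega>. ?t \<le> \<bar>median (map (\<lambda>j. cs_estimate 3 (\<omega> j) \<sigma> i) [1..<T]) - freq \<sigma> i\<bar>}"
  proof (intro measure_pmf.finite_measure_mono subsetI)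
    have "freq \<sigma> i \<le> \<tau> / 2" using light freq[OF i] by simp
    then show "\<omega> \<in> {\<omega>. ?t \<le> \<bar>median (map (\<lambda>j. cs_estimate 3 (\<omega> j) \<sigma> i) [1..<T]) - freq \<sigma> i\<bar>}"
      if "\<omega> \<in> {\<omega>. \<not> median (map (\<lambda>j. cs_estimate 3 (\<omega> j) \<sigma> i) [1..<T]) < \<tau>}" for \<omega>
      using that unfolding mem_Collect_eq by linarith
  qed simp
  also have "\<dots> \<le> ((24 / (?t * real ?w))\<^sup>2) ^ (T div 2)"
    using \<tau>0 w0 T i by (intro median_of_tables_tail) auto
  also have "\<dots> \<le> ((exp (-1))\<^sup>2) ^ (T div 2)"
    using q \<tau>0 w0 by (intro power_mono) auto
  also have "\<dots> = exp (- real (2 * (T div 2)))"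
    by (simp add: power_mult[symmetric] exp_of_nat_mult[symmetric])
  \<comment> \<open>An odd \<open>T\<close> loses 1 in \<open>2 * (T div 2)\<close>; this costs the
    factor \<open>e \<le> 3\<close> in the final bound.\<close>
  also have "\<dots> \<le> exp (1 - L)"
  proof -
    have "T \<le> 2 * (T div 2) + 1" by presburger
    then have "real T \<le> real (2 * (T div 2)) + 1" by linarith
    then have "L \<le> real (2 * (T div 2)) + 1" using T by linarith
    then show ?thesis by simp
  qed
  also have "\<dots> \<le> 3 / exp L" using exp_le by (simp add: exp_diff divide_right_mono)
  finally show ?thesis .
qed

section \<open>Contribution of each item and summation\<close>

text \<open>Two cutoffs are used. For the discard term it is \<open>1 / i \<ge> 2 * \<tau>\<close>,
  and below it the trivial probability bound 1 is affordable; for the keep term it is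
  \<open>i \<le> B\<close>, where the trivial bound costs only a harmonic sum. The constant is
  \<open>432 = 36 * 12\<close>, with 12 from the rounded width \<open>B div 6\<close>.\<close>

lemma item_error_le:
  fixes L \<tau> :: real
  assumes L: "1 \<le> L" and T: "2 \<le> T" "L \<le> real T" "real T \<le> 2 * L" and B: "6 * T \<le> B"
    and \<tau>: "\<tau> = 4000 * L / real B" and i: "i \<in> {1..n}"
  shows "freq \<sigma> i * measure_pmf.expectation (tables_pmf n B T)
      (\<lambda>\<omega>. \<bar>freq \<sigma> i - filtered_estimate T \<tau> \<omega> \<sigma> i\<bar>) \<le>
    (if 2 * \<tau> \<le> 1 / real i then (1152 * L / real B)\<^sup>2 else 1 / (real i)\<^sup>2) +
    432 / real B * ((if i \<le> B then 1 / real i else 0) + 3 / exp L * (1 / real i))"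
proof -
  let ?P = "Pi_pmf {1..<T} undefined (\<lambda>_. countsketch_pmf n 3 (B div (6 * T)))"
  let ?F = "\<lambda>\<omega>. median (map (\<lambda>j. cs_estimate 3 (\<omega> j) \<sigma> i) [1..<T]) < \<tau>"
  let ?p = "measure_pmf.prob ?P {\<omega>. ?F \<omega>}" and ?q = "measure_pmf.prob ?P {\<omega>. \<not> ?F \<omega>}"
  have i0: "0 < real i" and B0: "0 < real B" using i T B by auto
  have w: "36 / real (B div 6) \<le> 432 / real B"
  proof -
    have "real B / 12 \<le> real (B div 6)" using div_ge_half[of 6 B] T B by simp
    then have "36 / real (B div 6) \<le> 36 / (real B / 12)"
      using B0 by (intro divide_left_mono) auto
    then show ?thesis by simp
  qed
  have p: "?p * (1 / (real i)\<^sup>2) \<le> (if 2 * \<tau> \<le> 1 / real i then (1152 * L / real B)\<^sup>2 else 1 / (real i)\<^sup>2)"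
  proof (cases "2 * \<tau> \<le> 1 / real i")
    case True
    have "?p * (1 / (real i)\<^sup>2) \<le> (1152 * real i * L / real B)\<^sup>2 * (1 / (real i)\<^sup>2)"
      using prob_discard_heavy_le[OF L T(1,3) B \<tau> i True] by (intro mult_right_mono) auto
    also have "\<dots> = (1152 * L / real B)\<^sup>2"
      using i0 by (simp add: power_mult_distrib power_divide)
    finally show ?thesis using True by simp
  next
    case False
    have "?p * (1 / (real i)\<^sup>2) \<le> 1 * (1 / (real i)\<^sup>2)" by (intro mult_right_mono) auto
    then show ?thesis using False by simp
  qed
  have q: "?q * (1 / real i) \<le> (if i \<le> B then 1 / real i else 0) + 3 / exp L * (1 / real i)"
  proof (cases "i \<le> B")
    case True
    have "?q * (1 / real i) \<le> 1 * (1 / real i)" by (intro mult_right_mono) auto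
    moreover have "0 \<le> 3 / exp L * (1 / real i)" by simp
    ultimately show ?thesis unfolding if_P[OF True] by linarith
  next
    case False
    \<comment> \<open>Items beyond \<open>B\<close> lie well below the threshold, so
      \<open>prob_keep_light_le\<close> applies.\<close>
    have "2 / real i \<le> 2 / real B" using False B0 i0 by (intro divide_left_mono) auto
    also have "\<dots> \<le> \<tau>" unfolding \<tau> using L B0 by (intro divide_right_mono) auto
    finally have "2 / real i \<le> \<tau>" .
    then have "?q \<le> 3 / exp L" using T by (intro prob_keep_light_le[OF L _ T(2,3) B \<tau> i]) auto
    then have "?q * (1 / real i) \<le> 3 / exp L * (1 / real i)" by (intro mult_right_mono) auto
    then show ?thesis using False by simp
  qed
  have "measure_pmf.expectation (tables_pmf n B T) (\<lambda>\<omega>. \<bar>freq \<sigma> i - filtered_estimate T \<tau> \<omega> \<sigma> i\<bar>) \<le>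
      freq \<sigma> i * ?p + 36 / real (B div 6) * ?q"
    using T B by (intro filtered_expected_error i) (auto simp: div_greater_zero_iff)
  also have "\<dots> \<le> freq \<sigma> i * ?p + 432 / real B * ?q"
    using w by (intro add_left_mono mult_right_mono) auto
  finally have "freq \<sigma> i * measure_pmf.expectation (tables_pmf n B T)
      (\<lambda>\<omega>. \<bar>freq \<sigma> i - filtered_estimate T \<tau> \<omega> \<sigma> i\<bar>) \<le> freq \<sigma> i * (freq \<sigma> i * ?p + 432 / real B * ?q)"
    using freq[OF i] by (intro mult_left_mono) auto
  also have "\<dots> = ?p * (1 / (real i)\<^sup>2) + 432 / real B * (?q * (1 / real i))"
    by (simp add: freq[OF i] power2_eq_square add_divide_distrib mult_ac)
  also have "\<dots> \<le> (if 2 * \<tau> \<le> 1 / real i then (1152 * L / real B)\<^sup>2 else 1 / (real i)\<^sup>2) +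
    432 / real B * ((if i \<le> B then 1 / real i else 0) + 3 / exp L * (1 / real i))"
    using p q by (intro add_mono mult_left_mono) auto
  finally show ?thesis .
qed

text \<open>Discarding costs \<open>O(L / B)\<close> on both sides of its cutoff, and keeping costs
  \<open>O((ln B + 1) / B)\<close>.\<close>

lemma sum_item_error_le:
  fixes L \<tau> :: real
  assumes L: "1 \<le> L" and n: "exp L = ln (real n)"
    and T: "2 \<le> T" "L \<le> real T" "real T \<le> 2 * L" and B: "6 * T \<le> B"
    and \<tau>: "\<tau> = 4000 * L / real B"
  shows "(\<Sum>i=1..n. freq \<sigma> i * measure_pmf.expectation (tables_pmf n B T)
      (\<lambda>\<omega>. \<bar>freq \<sigma> i - filtered_estimate T \<tau> \<omega> \<sigma> i\<bar>)) \<le> 20000 * (ln (real B) + L) / real B"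
proof -
  have B0: "0 < real B" and B1: "1 \<le> B" using T B by auto
  then have \<tau>0: "0 < \<tau>" using L by (simp add: \<tau>)
  have n1: "1 \<le> n" using n by (cases n) auto
  \<comment> \<open>\<open>m\<close> turns the threshold condition into an index range: at most
    \<open>1 / (2 * \<tau>)\<close> items above it, and a tail of inverse squares of size at most
    \<open>4 * \<tau>\<close> below it.\<close>
  define m where "m = nat \<lfloor>1 / (2 * \<tau>)\<rfloor>"
  have m: "real m \<le> 1 / (2 * \<tau>)" "1 / (2 * \<tau>) \<le> real (Suc m)"
    using \<tau>0 by (auto simp: m_def) linarith
  have heavy_iff: "2 * \<tau> \<le> 1 / real i \<longleftrightarrow> i \<le> m" if "i \<in> {1..n}" for i
  proof -
    have "2 * \<tau> \<le> 1 / real i \<longleftrightarrow> real i \<le> 1 / (2 * \<tau>)"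
      using that \<tau>0 by (auto simp: field_simps)
    also have "\<dots> \<longleftrightarrow> i \<le> m"
      using \<tau>0 unfolding m_def by (simp add: le_nat_floor le_nat_iff le_floor_iff)
    finally show ?thesis .
  qed
  have "(\<Sum>i=1..n. if 2 * \<tau> \<le> 1 / real i then (1152 * L / real B)\<^sup>2 else 1 / (real i)\<^sup>2) =
      (\<Sum>i=1..n. (if i \<le> m then (1152 * L / real B)\<^sup>2 else 0) + (if m < i then 1 / (real i)\<^sup>2 else 0))"
    by (intro sum.cong) (auto simp: heavy_iff)
  also have "\<dots> = (\<Sum>i\<in>{1..n} \<inter> {i. i \<le> m}. (1152 * L / real B)\<^sup>2) +
      (\<Sum>i\<in>{1..n} \<inter> {i. m < i}. 1 / (real i)\<^sup>2)"
    by (simp add: sum.distrib sum.If_cases)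
  also have "(\<Sum>i\<in>{1..n} \<inter> {i. i \<le> m}. (1152 * L / real B)\<^sup>2) \<le> (\<Sum>i\<in>{1..m}. (1152 * L / real B)\<^sup>2)"
    by (intro sum_mono2) auto
  also have "\<dots> = real m * (1152 * L / real B)\<^sup>2" by simp
  also have "\<dots> \<le> 1 / (2 * \<tau>) * (1152 * L / real B)\<^sup>2"
    using m by (intro mult_right_mono) auto
  \<comment> \<open>Here \<open>1152\<^sup>2 / 8000 < 166\<close>.\<close>
  also have "\<dots> \<le> 166 * L / real B"
    using L B0 by (simp add: \<tau> field_simps power2_eq_square)
  also have "{1..n} \<inter> {i. m < i} = {Suc m..n}" by auto
  also have "(\<Sum>i\<in>{Suc m..n}. 1 / (real i)\<^sup>2) \<le> 2 / real (Suc m)"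
    by (rule sum_inverse_squares_tail_le)
  also have "\<dots> \<le> 2 / (1 / (2 * \<tau>))" using m \<tau>0 by (intro divide_left_mono) auto
  also have "\<dots> = 16000 * L / real B" by (simp add: \<tau>)
  finally have u: "(\<Sum>i=1..n. if 2 * \<tau> \<le> 1 / real i then (1152 * L / real B)\<^sup>2 else 1 / (real i)\<^sup>2) \<le>
      16166 * L / real B"
    by (simp add: add_divide_distrib[symmetric])
  have "(\<Sum>i=1..n. if i \<le> B then 1 / real i else 0) \<le> (\<Sum>i=1..B. 1 / real i)"
  proof -
    have "(\<Sum>i=1..n. if i \<le> B then 1 / real i else 0) = (\<Sum>i\<in>{1..n} \<inter> {i. i \<le> B}. 1 / real i)"
      by (simp add: sum.If_cases)
    also have "\<dots> \<le> (\<Sum>i=1..B. 1 / real i)" by (intro sum_mono2) auto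
    finally show ?thesis .
  qed
  also have "\<dots> \<le> 1 + ln (real B)" by (rule harmonic_sum_le[OF B1])
  finally have v: "(\<Sum>i=1..n. if i \<le> B then 1 / real i else 0) \<le> 1 + ln (real B)" .
  \<comment> \<open>The full harmonic sum is about \<open>ln n = exp L\<close>, which the keep
    probability \<open>3 / exp L\<close> cancels down to a constant.\<close>
  have "(\<Sum>i=1..n. 1 / real i) \<le> 1 + exp L"
    using harmonic_sum_le[OF n1] n by simp
  then have "3 / exp L * (\<Sum>i=1..n. 1 / real i) \<le> 3 / exp L * (1 + exp L)"
    by (rule mult_left_mono) simp
  also have "\<dots> \<le> 6"
    using L by (simp add: field_simps)
  finally have v': "3 / exp L * (\<Sum>i=1..n. 1 / real i) \<le> 6" .
  have "(\<Sum>i=1..n. freq \<sigma> i * measure_pmf.expectation (tables_pmf n B T)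
      (\<lambda>\<omega>. \<bar>freq \<sigma> i - filtered_estimate T \<tau> \<omega> \<sigma> i\<bar>)) \<le>
    (\<Sum>i=1..n. (if 2 * \<tau> \<le> 1 / real i then (1152 * L / real B)\<^sup>2 else 1 / (real i)\<^sup>2) +
      432 / real B * ((if i \<le> B then 1 / real i else 0) + 3 / exp L * (1 / real i)))"
    by (intro sum_mono item_error_le L T B \<tau>)
  also have "\<dots> = (\<Sum>i=1..n. if 2 * \<tau> \<le> 1 / real i then (1152 * L / real B)\<^sup>2 else 1 / (real i)\<^sup>2) +
      432 / real B * ((\<Sum>i=1..n. if i \<le> B then 1 / real i else 0) + 3 / exp L * (\<Sum>i=1..n. 1 / real i))"
    by (simp only: sum.distrib sum_distrib_left[symmetric])
  also have "\<dots> \<le> 16166 * L / real B + 432 / real B * ((1 + ln (real B)) + 6)"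
    using v v' by (intro add_mono u mult_left_mono) auto
  also have "\<dots> = (16166 * L + 432 * ln (real B) + 3024) / real B"
    by (simp add: add_divide_distrib algebra_simps)
  also have "\<dots> \<le> 20000 * (ln (real B) + L) / real B"
  proof (intro divide_right_mono)
    \<comment> \<open>The constant \<open>3024 = 432 * 7\<close> is absorbed by the slack
      \<open>20000 - 16166\<close> in the coefficient of \<open>L\<close>, since
      \<open>L \<ge> 1\<close>.\<close>
    have "0 \<le> ln (real B)" using B1 by simp
    then show "16166 * L + 432 * ln (real B) + 3024 \<le> 20000 * (ln (real B) + L)"
      using L by simp
  qed simp
  finally show ?thesis .
qed

end

section \<open>Normalization and choice of constants\<close>

text \<open>Linearity of expectation reduces the claim to \<open>sum_item_error_le\<close>, and the
  normalizer, being at least \<open>ln n\<close>, supplies the factor \<open>ln n\<close> in the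
  denominator. The polynomial in \<open>ln (ln n)\<close> is linear, so
  \<open>d = 1\<close>.\<close>

theorem theorem1:
  shows "\<exists>(a::real) (c::real) (K::real) (d::nat) (n0::nat). a > 0 \<and> c > 0 \<and> K > 0 \<and>
    (\<forall>n\<ge>n0. \<forall>(B::nat) (T::nat) (\<tau>::real) (\<sigma>::stream).
       real B \<ge> ln (real n) \<longrightarrow>
       T = nat \<lceil>a * ln (ln (real n))\<rceil> \<longrightarrow>
       \<tau> = c * ln (ln (real n)) / real B \<longrightarrow>
       stream_on n \<sigma> \<longrightarrow>
       (\<forall>i\<in>{1..n}. freq \<sigma> i = 1 / real i) \<longrightarrow>
       measure_pmf.expectation (tables_pmf n B T)
         (\<lambda>\<omega>. weighted_error n (freq \<sigma>) (filtered_estimate T \<tau> \<omega> \<sigma>))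
       \<le> K * (ln (real B) + ln (ln (real n)) ^ d) / (real B * ln (real n)))"
proof -
  have bound: "measure_pmf.expectation (tables_pmf n B T)
         (\<lambda>\<omega>. weighted_error n (freq \<sigma>) (filtered_estimate T \<tau> \<omega> \<sigma>))
       \<le> 20000 * (ln (real B) + ln (ln (real n)) ^ 1) / (real B * ln (real n))"
    if n: "nat \<lceil>exp (exp 48) :: real\<rceil> \<le> n" and B: "ln (real n) \<le> real B"
      and T: "T = nat \<lceil>1 * ln (ln (real n))\<rceil>" and \<tau>: "\<tau> = 4000 * ln (ln (real n)) / real B"
      and \<sigma>: "stream_on n \<sigma>" "\<forall>i\<in>{1..n}. freq \<sigma> i = 1 / real i" for n B T \<tau> \<sigma>
  proof -
    interpret zipf_stream n \<sigma> using \<sigma> by unfold_locales auto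
    define L where "L = ln (ln (real n))"
    have "exp (exp 48) \<le> real n" using n by linarith
    then have ln_n: "exp 48 \<le> ln (real n)"
      by (metis exp_gt_zero ln_exp ln_mono order_less_le_trans)
    have ln_n0: "0 < ln (real n)" using ln_n exp_gt_zero[of "48::real"] by linarith
    have L48: "48 \<le> L"
      unfolding L_def using ln_n ln_n0 by (metis exp_gt_zero ln_exp ln_mono)
    have eL: "exp L = ln (real n)" using ln_n0 by (simp add: L_def)
    have n1: "1 \<le> n" using ln_n0 by (cases n) auto
    \<comment> \<open>With \<open>a = 1\<close>, rounding up adds at most 1, so
      \<open>T \<le> 2 * L\<close> follows from \<open>L \<ge> 1\<close>.\<close>
    have T': "L \<le> real T" "real T \<le> L + 1" using T L48 unfolding L_def by linarith+
    text \<open>The threshold \<open>48\<close> gives \<open>exp L \<ge> L\<^sup>2 / 2 \<ge> 24 L\<close>, so the filter tables are not empty.\<close>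
    have "24 * L \<le> L\<^sup>2 / 2" using L48 by (simp add: power2_eq_square)
    also have "\<dots> \<le> exp L" using exp_lower_Taylor_quadratic[of L] L48 by linarith
    finally have "24 * L \<le> real B" using B eL by simp
    then have BT: "6 * T \<le> B" using T' L48 by linarith
    let ?p = "tables_pmf n B T"
    let ?S = "\<Sum>i=1..n. freq \<sigma> i"
    \<comment> \<open>Both widths must be positive: a uniform distribution on hash functions into no
      buckets is unspecified, and its support could not be shown finite.\<close>
    have "B div (6 * T) \<le> B div 6" using T' L48 by (intro div_le_mono2) auto
    moreover have "0 < B div (6 * T)" using BT T' L48 by (auto simp: div_greater_zero_iff)
    ultimately have "finite (set_pmf ?p)"
      unfolding tables_pmf_def by (intro finite_set_Pi_pmf finite_set_countsketch_pmf) auto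
    note int = integrable_measure_pmf_finite[OF this]
    have S: "ln (real n) \<le> ?S" using harmonic_sum_ge[OF n1] freq by simp
    have "measure_pmf.expectation ?p (\<lambda>\<omega>. weighted_error n (freq \<sigma>) (filtered_estimate T \<tau> \<omega> \<sigma>)) =
        1 / ?S * (\<Sum>i=1..n. freq \<sigma> i * measure_pmf.expectation ?p
          (\<lambda>\<omega>. \<bar>freq \<sigma> i - filtered_estimate T \<tau> \<omega> \<sigma> i\<bar>))"
      unfolding weighted_error_def by (simp add: int)
    also have "\<dots> \<le> 1 / ?S * (20000 * (ln (real B) + L) / real B)"
      using S ln_n0 T' L48 BT \<tau> eL
      by (intro mult_left_mono sum_item_error_le) (auto simp: L_def)
    also have "\<dots> \<le> 1 / ln (real n) * (20000 * (ln (real B) + L) / real B)"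
      using S ln_n0 T' L48 BT
      by (intro mult_right_mono divide_left_mono) (auto intro!: divide_nonneg_nonneg)
    finally show ?thesis by (simp add: L_def mult.commute)
  qed
  show ?thesis
    by (rule exI[of _ 1], rule exI[of _ 4000], rule exI[of _ 20000], rule exI[of _ 1],
        rule exI[of _ "nat \<lceil>exp (exp 48) :: real\<rceil>"]) (use bound in auto)
qed

end
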